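(* Let $m \geq 4$ be an integer, $q$ a prime power, $n$ a positive integer with $m \le n+2$, and $k = \lfloor m/2 \rfloor$. If $A$ is an $m$-general set in $\mathbb{F}_q^n$, then \[ |A| \leq \frac{k\, q^{n/k}}{(q-1)^{1-2/k}(q-2)^{1/k}} \quad \text{if } q > 2, \] and \[ |A| \leq (k!)^{1/k}\, 2^{n/k} + k \quad \text{if } q = 2. \]
   Context: A set $A \subseteq \mathbb{F}_q^n$ with $|A| \ge m$ is called $m$-general (for $3 \le m \le n+2$) if no $m$ points of $A$ lie on a single $(m-2)$-dimensional affine subspace (flat) of $\mathbb{F}_q^n$; equivalently, every $m$-element subset of $A$ is affinely independent (a set of points is affinely dependent if there is a linear combination $\sum_j c_j \mathbf{a}_j = \mathbf{0}$ with $\sum_j c_j = 0$ and the $c_j$ not all zero). *)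

theory Defs
  imports "HOL-Analysis.Analysis"
begin

(* F_q^n is rendered as the type ('a, 'n) vec of vectors over a finite field type 'a with
   q = CARD('a) and n = CARD('n). The affine notions of HOL-Analysis (affine, aff_dim,
   affine_dependent) exist only for real vector spaces, so flats over 'a are defined here from the
   linear notions vec.subspace and vec.dim. *)

definition is_flat :: "nat \<Rightarrow> ('a::field ^ 'n) set \<Rightarrow> bool" where
  "is_flat d F \<longleftrightarrow> (\<exists>a V. vec.subspace V \<and> vec.dim V = d \<and> F = (\<lambda>v. a + v) ` V)"

definition affinely_dependent :: "('a::field ^ 'n) set \<Rightarrow> bool" where
  "affinely_dependent S \<longleftrightarrow>
     (\<exists>c. (\<Sum>x\<in>S. c x *s x) = 0 \<and> (\<Sum>x\<in>S. c x) = 0 \<and> (\<exists>x\<in>S. c x \<noteq> 0))"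

definition general_set :: "nat \<Rightarrow> ('a::{field,finite} ^ 'n) set \<Rightarrow> bool" where
  "general_set m A \<longleftrightarrow>
     3 \<le> m \<and> m \<le> CARD('n) + 2 \<and> m \<le> card A \<and>
     (\<forall>S F. S \<subseteq> A \<longrightarrow> card S = m \<longrightarrow> is_flat (m - 2) F \<longrightarrow> \<not> S \<subseteq> F)"

lemma affinely_dependent_iff_differences:
  fixes S :: "('a::field ^ 'n) set"
  assumes fin: "finite S" and a: "a \<in> S"
  shows "affinely_dependent S \<longleftrightarrow> vec.dependent ((\<lambda>x. x - a) ` (S - {a}))"
proof -
  let ?D = "(\<lambda>x. x - a) ` (S - {a})"
  have inj: "inj_on (\<lambda>x. x - a) (S - {a})" by (auto simp: inj_on_def)
  have finD: "finite ?D" using fin by simp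
  show ?thesis
  proof
    assume "affinely_dependent S"
    then obtain c where c0: "(\<Sum>x\<in>S. c x *s x) = 0" and c1: "(\<Sum>x\<in>S. c x) = 0"
      and c2: "\<exists>x\<in>S. c x \<noteq> 0" unfolding affinely_dependent_def by blast
    define u where "u v = c (v + a)" for v
    have ca: "c a = - (\<Sum>x\<in>S-{a}. c x)"
      using c1 by (simp add: sum.remove[OF fin a] eq_neg_iff_add_eq_0)
    have "(\<Sum>v\<in>?D. u v *s v) = (\<Sum>x\<in>S-{a}. c x *s (x - a))"
      by (simp add: sum.reindex[OF inj] u_def)
    also have "\<dots> = (\<Sum>x\<in>S-{a}. c x *s x) - (\<Sum>x\<in>S-{a}. c x) *s a"
      by (simp add: vec.scale_right_diff_distrib sum_subtractf vec.scale_sum_left)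
    also have "\<dots> = (\<Sum>x\<in>S. c x *s x)"
      by (simp add: sum.remove[OF fin a] ca)
    finally have s: "(\<Sum>v\<in>?D. u v *s v) = 0" using c0 by simp
    have "\<exists>x\<in>S-{a}. c x \<noteq> 0"
    proof (rule ccontr)
      assume n: "\<not> ?thesis"
      then have "c a = 0" using ca by simp
      then show False using n c2 by blast
    qed
    then have "\<exists>v\<in>?D. u v \<noteq> 0" by (auto simp: u_def)
    then show "vec.dependent ?D" using s vec.dependent_finite[OF finD] by blast
  next
    assume "vec.dependent ?D"
    then obtain u where u0: "(\<Sum>v\<in>?D. u v *s v) = 0" and u1: "\<exists>v\<in>?D. u v \<noteq> 0"
      using vec.dependent_finite[OF finD] by blast
    define c where
      "c x = (if x = a then - (\<Sum>y\<in>S-{a}. u (y - a)) else u (x - a))" for x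
    have r: "(\<Sum>x\<in>S-{a}. c x) = (\<Sum>y\<in>S-{a}. u (y - a))"
      by (intro sum.cong) (auto simp: c_def)
    have ca: "c a = - (\<Sum>x\<in>S-{a}. c x)" by (simp only: r) (simp add: c_def)
    have "(\<Sum>x\<in>S. c x *s x) = (\<Sum>x\<in>S-{a}. c x *s x) - (\<Sum>x\<in>S-{a}. c x) *s a"
      by (simp add: sum.remove[OF fin a] ca)
    also have "\<dots> = (\<Sum>x\<in>S-{a}. c x *s (x - a))"
      by (simp add: vec.scale_right_diff_distrib sum_subtractf vec.scale_sum_left)
    also have "\<dots> = (\<Sum>x\<in>S-{a}. u (x - a) *s (x - a))"
      by (intro sum.cong) (auto simp: c_def)
    also have "\<dots> = (\<Sum>v\<in>?D. u v *s v)"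
      by (simp add: sum.reindex[OF inj])
    finally have s: "(\<Sum>x\<in>S. c x *s x) = 0" using u0 by simp
    have s2: "(\<Sum>x\<in>S. c x) = 0" by (simp add: sum.remove[OF fin a] ca)
    have "\<exists>x\<in>S. c x \<noteq> 0" using u1 by (auto simp: c_def)
    with s s2 show "affinely_dependent S" unfolding affinely_dependent_def by blast
  qed
qed

lemma ex_subspace_dim:
  fixes D :: "('a::field ^ 'n) set"
  assumes "vec.dim D \<le> d" "d \<le> CARD('n)"
  shows "\<exists>V. vec.subspace V \<and> vec.dim V = d \<and> D \<subseteq> V"
proof -
  obtain B where B: "B \<subseteq> D" "vec.independent B" "D \<subseteq> vec.span B" "card B = vec.dim D"
    by (rule vec.basis_exists)
  define C where "C = vec.extend_basis B"
  have C: "B \<subseteq> C" "vec.independent C" "vec.span C = UNIV"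
    using vec.extend_basis_superset[OF B(2)] vec.independent_extend_basis[OF B(2)]
      vec.span_extend_basis[OF B(2)] by (auto simp: C_def)
  have finC: "finite C" using vec.independent_bound_general[OF C(2)] by blast
  have "card C = CARD('n)"
    using vec.dim_span_eq_card_independent[OF C(2)] C(3)
    by (simp add: vec_dim_card card_cart_basis)
  then obtain E where E: "B \<subseteq> E" "E \<subseteq> C" "card E = d"
    using exists_subset_between[OF _ _ C(1) finC, of d] B(4) assms by metis
  have "vec.independent E" using C(2) E(2) vec.independent_mono by blast
  then have "vec.dim (vec.span E) = d"
    using vec.dim_span_eq_card_independent E(3) by blast
  moreover have "D \<subseteq> vec.span E" using B(3) vec.span_mono[OF E(1)] by (rule subset_trans)
  ultimately show ?thesis using vec.subspace_span[of E] by (intro exI[of _ "vec.span E"]) simp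
qed

lemma subset_flat_iff_affinely_dependent:
  fixes S :: "('a::field ^ 'n) set"
  assumes card: "card S = m" and m: "3 \<le> m" "m \<le> CARD('n) + 2"
  shows "(\<exists>F. is_flat (m - 2) F \<and> S \<subseteq> F) \<longleftrightarrow> affinely_dependent S"
proof -
  have fin: "finite S" using card m(1) by (metis card.infinite not_numeral_le_zero)
  obtain a where a: "a \<in> S" using card m(1) by fastforce
  let ?D = "(\<lambda>x. x - a) ` (S - {a})"
  have finD: "finite ?D" using fin by simp
  have inj: "inj_on (\<lambda>x. x - a) (S - {a})" by (auto simp: inj_on_def)
  have cD: "card ?D = m - 1"
    by (simp add: card_image[OF inj] card_Diff_singleton[OF a] card)
  have dep: "vec.dependent ?D \<longleftrightarrow> vec.dim ?D \<le> m - 2"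
  proof
    assume d: "vec.dependent ?D"
    obtain B where B: "B \<subseteq> ?D" "vec.independent B" "card B = vec.dim ?D"
      by (rule vec.basis_exists)
    have "B \<noteq> ?D" using B(2) d by blast
    then have "card B < card ?D" using B(1) finD by (simp add: psubset_card_mono psubsetI)
    then show "vec.dim ?D \<le> m - 2" using B(3) cD by simp
  next
    assume "vec.dim ?D \<le> m - 2"
    then have "vec.dim ?D \<noteq> card ?D" using cD m(1) by linarith
    then show "vec.dependent ?D" using vec.dim_eq_card_independent by blast
  qed
  have "(\<exists>F. is_flat (m - 2) F \<and> S \<subseteq> F) \<longleftrightarrow> vec.dim ?D \<le> m - 2"
  proof
    assume "\<exists>F. is_flat (m - 2) F \<and> S \<subseteq> F"
    then obtain b V where V: "vec.subspace V" "vec.dim V = m - 2" and S: "S \<subseteq> (\<lambda>v. b + v) ` V"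
      unfolding is_flat_def by blast
    have "?D \<subseteq> V"
    proof
      fix y assume "y \<in> ?D"
      then obtain x where x: "x \<in> S" "y = x - a" by blast
      obtain v w where "v \<in> V" "w \<in> V" "x = b + v" "a = b + w" using S x(1) a by blast
      then show "y \<in> V" using x(2) vec.subspace_diff[OF V(1)] by simp
    qed
    then show "vec.dim ?D \<le> m - 2" using vec.dim_subset V(2) by metis
  next
    assume "vec.dim ?D \<le> m - 2"
    moreover have "m - 2 \<le> CARD('n)" using m(2) by linarith
    ultimately obtain V where V: "vec.subspace V" "vec.dim V = m - 2" "?D \<subseteq> V"
      using ex_subspace_dim by blast
    have "S \<subseteq> (\<lambda>v. a + v) ` V"
    proof
      fix x assume x: "x \<in> S"
      have "x - a \<in> V"
        using V(3) x vec.subspace_0[OF V(1)] by (cases "x = a") auto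
      then show "x \<in> (\<lambda>v. a + v) ` V" by (intro image_eqI[of _ _ "x - a"]) simp_all
    qed
    then show "\<exists>F. is_flat (m - 2) F \<and> S \<subseteq> F" using V(1,2) unfolding is_flat_def by blast
  qed
  then show ?thesis using dep affinely_dependent_iff_differences[OF fin a] by blast
qed

lemma general_set_iff_affinely_dependent:
  fixes A :: "('a::{field,finite} ^ 'n) set"
  shows "general_set m A \<longleftrightarrow>
     3 \<le> m \<and> m \<le> CARD('n) + 2 \<and> m \<le> card A \<and>
     (\<forall>S. S \<subseteq> A \<longrightarrow> card S = m \<longrightarrow> \<not> affinely_dependent S)"
proof (cases "3 \<le> m \<and> m \<le> CARD('n) + 2")
  case True
  have "(\<forall>F. is_flat (m - 2) F \<longrightarrow> \<not> S \<subseteq> F) \<longleftrightarrow> \<not> affinely_dependent S"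
    if "card S = m" for S :: "('a ^ 'n) set"
    using subset_flat_iff_affinely_dependent[OF that] True by blast
  then show ?thesis unfolding general_set_def by metis
next
  case False
  then show ?thesis unfolding general_set_def by blast
qed

end

theory Submission
  imports Defs
begin

text \<open>
  Fix \<open>s\<close> and consider the linear combinations of exactly \<open>k\<close> points of \<open>A\<close> with nonzero
  coefficients of sum \<open>s\<close>. If two of them had the same value, their difference would be an affine
  dependence with support of size at most \<open>2 k \<le> m\<close>, so they are pairwise distinct and there are at
  most \<open>q ^ n\<close> of them. Their number is \<open>card A choose k\<close> times the number of admissible coefficient
  vectors, which is at least \<open>(q - 1) ^ (k - 2) * (q - 2)\<close> for every \<open>s\<close>, and at least \<open>1\<close> for
  \<open>s = of_nat k\<close>.
\<close>

text \<open>General position speaks only of subsets of exactly \<open>m\<close> points. Since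
  \<open>card A\<close> is at least \<open>m\<close>, \<open>T\<close> extends to such a subset of
  \<open>A\<close>, and a dependence supported on \<open>T\<close>, extended by zero, is one on the
  larger set.\<close>

lemma general_set_no_dependence:
  fixes A :: "('a::{field,finite} ^ 'n) set"
  assumes A: "general_set m A" and T: "T \<subseteq> A" "card T \<le> m"
    and d: "\<And>x. x \<notin> T \<Longrightarrow> d x = 0" "(\<Sum>x\<in>UNIV. d x) = 0" "(\<Sum>x\<in>UNIV. d x *s x) = 0"
  shows "d = (\<lambda>x. 0)"
proof -
  have "m \<le> card A"
    and indep: "\<And>S. S \<subseteq> A \<Longrightarrow> card S = m \<Longrightarrow> \<not> affinely_dependent S"
    using A unfolding general_set_iff_affinely_dependent by auto
  then obtain S where S: "T \<subseteq> S" "S \<subseteq> A" "card S = m"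
    using exists_subset_between[OF T(2) _ T(1)] by auto
  have "(\<Sum>x\<in>S. d x) = (\<Sum>x\<in>UNIV. d x)" "(\<Sum>x\<in>S. d x *s x) = (\<Sum>x\<in>UNIV. d x *s x)"
    using S(1) d(1) by (intro sum.mono_neutral_left; force)+
  then have "\<forall>x\<in>S. d x = 0"
    using indep[OF S(2,3)] d(2,3) unfolding affinely_dependent_def by metis
  then show ?thesis using S(1) d(1) by blast
qed

text \<open>Coefficient vectors live on the whole index type with support exactly \<open>S\<close>:
  vectors for different sets can then be subtracted pointwise, and the families for different
  \<open>S\<close> are disjoint.\<close>

definition weightings :: "'b set \<Rightarrow> 'a \<Rightarrow> ('b::finite \<Rightarrow> 'a::{field,finite}) set" where
  "weightings S s = {c. {x. c x \<noteq> 0} = S \<and> (\<Sum>x\<in>UNIV. c x) = s}"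

text \<open>The bound \<open>N\<close> and the sum \<open>s\<close> stay free so that both cases of
  the theorem can be served; injectivity only needs all combinations to share the same sum
  \<open>s\<close>.\<close>

lemma binomial_times_weightings_le:
  fixes A :: "('a::{field,finite} ^ 'n) set" and s :: 'a
  assumes A: "general_set m A" and k: "2 * k \<le> m"
    and N: "\<And>S. S \<subseteq> A \<Longrightarrow> card S = k \<Longrightarrow> N \<le> card (weightings S s)"
  shows "(card A choose k) * N \<le> CARD('a) ^ CARD('n)"
proof -
  let ?P = "{S. S \<subseteq> A \<and> card S = k}"
  let ?f = "\<lambda>c. \<Sum>x\<in>UNIV. c x *s x :: 'a ^ 'n"
  have inj: "inj_on ?f (\<Union>S\<in>?P. weightings S s)"
  proof (rule inj_onI)
    fix c e assume "c \<in> (\<Union>S\<in>?P. weightings S s)" "e \<in> (\<Union>S\<in>?P. weightings S s)" and eq: "?f c = ?f e"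
    then obtain S T where S: "S \<subseteq> A" "card S = k" "c \<in> weightings S s"
      and T: "T \<subseteq> A" "card T = k" "e \<in> weightings T s"
      by auto
    have "(\<lambda>x. c x - e x) = (\<lambda>x. 0)"
    proof (rule general_set_no_dependence[OF A])
      show "S \<union> T \<subseteq> A" using S T by blast
      show "card (S \<union> T) \<le> m" using card_Un_le[of S T] S T k by linarith
      show "c x - e x = 0" if "x \<notin> S \<union> T" for x
        using that S(3) T(3) by (auto simp: weightings_def)
      show "(\<Sum>x\<in>UNIV. c x - e x) = 0"
        using S(3) T(3) by (simp add: sum_subtractf weightings_def)
      show "(\<Sum>x\<in>UNIV. (c x - e x) *s x) = 0"
        using eq by (simp add: vec.scale_left_diff_distrib sum_subtractf)
    qed
    then show "c = e" by (simp add: fun_eq_iff)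
  qed
  have "(card A choose k) * N = (\<Sum>S\<in>?P. N)"
    by (simp add: n_subsets)
  also have "\<dots> \<le> (\<Sum>S\<in>?P. card (weightings S s))"
    using N by (intro sum_mono) auto
  also have "\<dots> = card (\<Union>S\<in>?P. weightings S s)"
    by (rule card_UN_disjoint[symmetric]) (auto simp: weightings_def)
  also have "\<dots> = card (?f ` (\<Union>S\<in>?P. weightings S s))"
    using inj by (rule card_image[symmetric])
  also have "\<dots> \<le> card (UNIV :: ('a ^ 'n) set)"
    by (rule card_mono) auto
  finally show ?thesis by (simp add: CARD_vec)
qed

lemma sum_fun_upd_UNIV:
  fixes c :: "'b::finite \<Rightarrow> 'a::ab_group_add"
  assumes "c x = 0"
  shows "(\<Sum>y\<in>UNIV. (c(x := t)) y) = t + (\<Sum>y\<in>UNIV. c y)"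
  using assms by (simp add: sum.remove[of UNIV x])

text \<open>Weightings are sorted by their nonzero value \<open>t\<close> at \<open>x\<close>;
  erasing that value leaves a weighting of \<open>S\<close> with sum \<open>s - t\<close>.\<close>

lemma card_weightings_insert:
  assumes "x \<notin> S"
  shows "card (weightings (insert x S) (s::'a::{field,finite})) = (\<Sum>t\<in>-{0}. card (weightings S (s - t)))"
proof -
  let ?U = "\<lambda>t. (\<lambda>c. c(x := t)) ` weightings S (s - t)"
  have zero: "c x = 0" if "c \<in> weightings S t" for c t
    using that assms by (auto simp: weightings_def)
  have "weightings (insert x S) s = (\<Union>t\<in>-{0}. ?U t)"
  proof (intro equalityI subsetI)
    fix c assume c: "c \<in> weightings (insert x S) s"
    have "(\<Sum>y\<in>UNIV. c y) = c x + (\<Sum>y\<in>UNIV. (c(x := 0)) y)"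
      using sum_fun_upd_UNIV[of "c(x := 0)" x "c x"] by simp
    moreover have "{y. (c(x := 0)) y \<noteq> 0} = S" "c x \<noteq> 0"
      using c assms by (auto simp: weightings_def)
    ultimately have "c(x := 0) \<in> weightings S (s - c x)"
      using c by (auto simp: weightings_def algebra_simps)
    then show "c \<in> (\<Union>t\<in>-{0}. ?U t)"
      using \<open>c x \<noteq> 0\<close> by (intro UN_I[of "c x"] image_eqI[of _ _ "c(x := 0)"]) auto
  next
    fix c assume "c \<in> (\<Union>t\<in>-{0}. ?U t)"
    then obtain t d where t: "t \<noteq> 0" "d \<in> weightings S (s - t)" "c = d(x := t)" by auto
    then have "(\<Sum>y\<in>UNIV. c y) = s"
      using sum_fun_upd_UNIV[of d x t] zero[OF t(2)] by (simp add: weightings_def)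
    moreover have "{y. c y \<noteq> 0} = insert x S"
      using t by (auto simp: weightings_def)
    ultimately show "c \<in> weightings (insert x S) s" by (simp add: weightings_def)
  qed
  also have "card (\<Union>t\<in>-{0}. ?U t) = (\<Sum>t\<in>-{0}. card (?U t))"
  proof (rule card_UN_disjoint)
    show "\<forall>i\<in>-{0}. \<forall>j\<in>-{0}. i \<noteq> j \<longrightarrow> ?U i \<inter> ?U j = {}"
      by (auto dest: fun_cong[of _ _ x])
  qed auto
  also have "\<dots> = (\<Sum>t\<in>-{0}. card (weightings S (s - t)))"
  proof (rule sum.cong)
    fix t
    \<comment> \<open>Members of \<open>weightings S (s - t)\<close> vanish at \<open>x\<close>, so
      resetting the value at \<open>x\<close> to 0 recovers them.\<close>
    have "inj_on (\<lambda>c. c(x := t)) (weightings S (s - t))"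
      by (intro inj_onI) (metis fun_upd_triv fun_upd_upd zero)
    then show "card (?U t) = card (weightings S (s - t))" by (rule card_image)
  qed simp
  finally show ?thesis .
qed

text \<open>Any value \<open>t\<close> at \<open>x\<close> other than 0 and \<open>s\<close> forces
  the nonzero value \<open>s - t\<close> at \<open>y\<close>. For \<open>s = 0\<close> only one
  value is excluded, so the count is larger and the bound is uniform in \<open>s\<close>.\<close>

lemma card_weightings_pair_ge:
  fixes s :: "'a::{field,finite}"
  assumes "x \<noteq> y"
  shows "CARD('a) - 2 \<le> card (weightings {x, y} s)"
proof -
  have *: "1 \<le> card (weightings {y} t)" if "t \<noteq> 0" for t :: 'a
  proof -
    have "(\<lambda>z. 0)(y := t) \<in> weightings {y} t"
      using that sum_fun_upd_UNIV[of "\<lambda>z. 0 :: 'a" y t] by (auto simp: weightings_def)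
    then show ?thesis by (metis One_nat_def Suc_leI card_gt_0_iff empty_iff finite)
  qed
  have "CARD('a) - 2 \<le> CARD('a) - card {0, s}"
    by (intro diff_le_mono2) (simp add: card_insert_if)
  also have "\<dots> = card (-{0, s})" by (simp add: Compl_eq_Diff_UNIV card_Diff_subset)
  also have "\<dots> = (\<Sum>t\<in>-{0, s}. 1)" by simp
  also have "\<dots> \<le> (\<Sum>t\<in>-{0, s}. card (weightings {y} (s - t)))"
    using * by (intro sum_mono) auto
  also have "\<dots> \<le> (\<Sum>t\<in>-{0}. card (weightings {y} (s - t)))"
    by (intro sum_mono2) auto
  also have "\<dots> = card (weightings {x, y} s)"
    using assms by (simp add: card_weightings_insert)
  finally show ?thesis .
qed

text \<open>Each point beyond the last two takes any of the \<open>q - 1\<close> nonzero values,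
  where \<open>q = CARD('a)\<close>. The remaining sum changes with that value, so the induction
  runs over all \<open>s\<close>.\<close>

lemma card_weightings_ge:
  fixes s :: "'a::{field,finite}"
  assumes "card S = j + 2"
  shows "(CARD('a) - 1) ^ j * (CARD('a) - 2) \<le> card (weightings S s)"
  using assms
proof (induction j arbitrary: S s)
  case 0
  then obtain x y where "S = {x, y}" "x \<noteq> y" by (metis add_0 card_2_iff)
  then show ?case using card_weightings_pair_ge by simp
next
  case (Suc j)
  then obtain x T where S: "S = insert x T" "x \<notin> T" "card T = j + 2"
    using card_Suc_eq[of S "j + 2"] by auto
  have "(CARD('a) - 1) ^ Suc j * (CARD('a) - 2)
      = (\<Sum>t\<in>-{0::'a}. (CARD('a) - 1) ^ j * (CARD('a) - 2))"
    by (simp add: Compl_eq_Diff_UNIV card_Diff_subset)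
  also have "\<dots> \<le> (\<Sum>t\<in>-{0}. card (weightings T (s - t)))"
    using Suc.IH[OF S(3)] by (intro sum_mono)
  finally show ?case by (simp add: S card_weightings_insert)
qed

text \<open>The previous bound is zero over the field of two elements. There the all-ones weighting,
  whose sum is \<open>card S\<close> read in the field, serves instead.\<close>

lemma card_weightings_of_nat_ge_1:
  "1 \<le> card (weightings S (of_nat (card S) :: 'a::{field,finite}))"
proof -
  have "indicator S \<in> weightings S (of_nat (card S) :: 'a)"
    by (auto simp: weightings_def indicator_def of_bool_def sum.If_cases)
  then show ?thesis by (metis One_nat_def Suc_leI card_gt_0_iff empty_iff finite)
qed

text \<open>The right side is the falling factorial \<open>n (n - 1) ... (n - k + 1)\<close>, and
  each of its \<open>k\<close> factors is at least \<open>n - k\<close>.\<close>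

lemma diff_power_le_fact_times_binomial:
  assumes "k \<le> n"
  shows "(n - k) ^ k \<le> fact k * (n choose k)"
proof -
  have "(\<Prod>i<k. n - k) \<le> (\<Prod>i<k. n - i)"
    by (intro prod_mono) auto
  also have "real (\<Prod>i<k. n - i) = (\<Prod>i=0..<k. real n - real i)"
    using assms by (auto intro!: prod.cong simp: atLeast0LessThan of_nat_diff)
  then have "real (\<Prod>i<k. n - i) = real (fact k * (n choose k))"
    by (simp add: binomial_gbinomial gbinomial_mult_fact)
  then have "(\<Prod>i<k. n - i) = fact k * (n choose k)"
    using of_nat_eq_iff by blast
  finally show ?thesis by simp
qed

lemma le_powr_inverse_if_power_le:
  fixes x y :: real
  assumes "x ^ k \<le> y" "0 \<le> x" "0 < k"
  shows "x \<le> y powr (1 / real k)"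
proof -
  have "0 \<le> y" using assms(1,2) zero_le_power order_trans by blast
  have "x = root k (x ^ k)" using assms by (simp only: real_root_power_cancel)
  also have "\<dots> \<le> root k y" using assms by simp
  also have "\<dots> = y powr (1 / real k)"
    using assms(3) \<open>0 \<le> y\<close> by (simp add: root_powr_inverse)
  finally show ?thesis .
qed

theorem theorem3p1:
  fixes A :: "('a::{field,finite} ^ 'n) set" and m q n k :: nat
  assumes "m \<ge> 4"
    and "q = CARD('a)"
    and "n = CARD('n)"
    and "m \<le> n + 2"
    and "k = m div 2"
    and "general_set m A"
  shows "(q > 2 \<longrightarrow>
           real (card A) \<le> real k * real q powr (real n / real k) /
             ((real q - 1) powr (1 - 2 / real k) * (real q - 2) powr (1 / real k))) \<and>
         (q = 2 \<longrightarrow>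
           real (card A) \<le> fact k powr (1 / real k) * 2 powr (real n / real k) + real k)"
proof (intro conjI impI)
  have k: "2 \<le> k" "2 * k \<le> m" using assms(1,5) by auto
  have kA: "k \<le> card A" using k assms(6) by (simp add: general_set_def)
  {
    assume q: "q > 2"
    let ?D = "(real q - 1) ^ (k - 2) * (real q - 2)"
    have D: "0 < ?D" using q by simp
    \<comment> \<open>The weighting bound holds for every sum, so \<open>s = 0\<close> is an
      arbitrary choice.\<close>
    have "(card A choose k) * ((q - 1) ^ (k - 2) * (q - 2)) \<le> q ^ n"
      unfolding assms(2,3)
      using k by (intro binomial_times_weightings_le[OF assms(6) k(2), where s = 0] card_weightings_ge) auto
    then have "real ((card A choose k) * ((q - 1) ^ (k - 2) * (q - 2))) \<le> real (q ^ n)"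
      by (simp only: of_nat_le_iff)
    then have "real (card A choose k) * ?D \<le> real q ^ n"
      using q by (simp add: of_nat_diff)
    then have "real (card A choose k) \<le> real q ^ n / ?D"
      using D by (simp only: pos_le_divide_eq)
    moreover have "(real (card A) / real k) ^ k \<le> real (card A choose k)"
      using binomial_ge_n_over_k_pow_k[OF kA, where 'a = real] by simp
    ultimately have "(real (card A) / real k) ^ k \<le> real q ^ n / ?D" by linarith
    then have "real (card A) / real k \<le> (real q ^ n / ?D) powr (1 / real k)"
      using k by (intro le_powr_inverse_if_power_le) auto
    also have "\<dots> = (real q ^ n) powr (1 / real k)
        / (((real q - 1) ^ (k - 2)) powr (1 / real k) * (real q - 2) powr (1 / real k))"
      using q by (simp add: powr_divide powr_mult)
    also have "(real q ^ n) powr (1 / real k) = real q powr (real n / real k)"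
      using q by (simp add: powr_powr flip: powr_realpow)
    \<comment> \<open>The exponent is \<open>(k - 2) / k\<close>, with \<open>k - 2\<close> an
      honest difference because \<open>k\<close> is at least 2.\<close>
    also have "((real q - 1) ^ (k - 2)) powr (1 / real k) = (real q - 1) powr (1 - 2 / real k)"
      using q k by (simp add: powr_powr of_nat_diff diff_divide_distrib flip: powr_realpow)
    finally show "real (card A) \<le> real k * real q powr (real n / real k) /
        ((real q - 1) powr (1 - 2 / real k) * (real q - 2) powr (1 / real k))"
      using k by (simp add: pos_divide_le_eq mult.commute)
  }
  {
    assume q: "q = 2"
    \<comment> \<open>All supports have \<open>k\<close> points, so the all-ones weightings share
      the sum \<open>of_nat k\<close>.\<close>
    have "(card A choose k) * 1 \<le> q ^ n"
      unfolding assms(2,3)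
      using card_weightings_of_nat_ge_1
      by (intro binomial_times_weightings_le[OF assms(6) k(2), where s = "of_nat k"]) blast
    then have "fact k * (card A choose k) \<le> fact k * 2 ^ n"
      using q by simp
    with diff_power_le_fact_times_binomial[OF kA]
    have "(card A - k) ^ k \<le> fact k * 2 ^ n" by linarith
    then have "real ((card A - k) ^ k) \<le> real (fact k * 2 ^ n)"
      by (simp only: of_nat_le_iff)
    \<comment> \<open>Truncated subtraction agrees with the real one because
      \<open>k \<le> card A\<close>; the shift by \<open>k\<close> becomes the additive term of the
      bound.\<close>
    then have "(real (card A) - real k) ^ k \<le> fact k * 2 ^ n"
      using kA by (simp add: of_nat_diff)
    then have "real (card A) - real k \<le> (fact k * 2 ^ n) powr (1 / real k)"
      using k kA by (intro le_powr_inverse_if_power_le) auto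
    also have "\<dots> = fact k powr (1 / real k) * 2 powr (real n / real k)"
      by (simp add: powr_mult powr_powr flip: powr_realpow)
    finally show "real (card A) \<le> fact k powr (1 / real k) * 2 powr (real n / real k) + real k"
      by simp
  }
qed

end
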